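(* For every threshold $\delta\in(\frac12,1]$ and every integer $n\ge 2$, $$\sup_{(X_1,X_2,\dots,X_n)\in\mathcal{C}}\mathbb{P}\Big(\max_{1\le i<j\le n}|X_i-X_j|\ge\delta\Big)=\frac{n(1-\delta)}{2-\delta}\wedge 1,$$ where the supremum is over all coherent vectors $(X_1,\dots,X_n)$ (on all probability spaces).
   Context: A vector $(X_1,\dots,X_n)$ of random variables on a probability space $(\Omega,\mathcal{F},\mathbb{P})$ is called coherent, written $(X_1,\dots,X_n)\in\mathcal{C}$, if there exist sub-$\sigma$-fields $\mathcal{G}_1,\dots,\mathcal{G}_n$ of $\mathcal{F}$ and an event $A\in\mathcal{F}$ such that $X_j=\mathbb{P}(A|\mathcal{G}_j)$ almost surely for $j=1,\dots,n$. The probability space is allowed to vary in the supremum. The notation $a\wedge b$ means $\min(a,b)$. *)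

theory Defs
  imports "HOL-Probability.Probability"
begin

text \<open>A sub-\<open>\<sigma>\<close>-field is a measure \<open>G j\<close> of which only the \<open>\<sigma>\<close>-algebra matters:
  \<^const>\<open>real_cond_exp\<close> uses \<open>M\<close> restricted to it. The conditional probability of \<open>A\<close>
  given \<open>G j\<close> is the conditional expectation of the indicator of \<open>A\<close>. The vector is
  \<open>(X 1, \<dots>, X n)\<close>; values of \<open>X\<close> at other indices are irrelevant.\<close>

definition coherent :: "'a measure \<Rightarrow> nat \<Rightarrow> (nat \<Rightarrow> 'a \<Rightarrow> real) \<Rightarrow> bool" where
  "coherent M n X \<longleftrightarrow>
     prob_space M \<and>
     (\<forall>j\<in>{1..n}. X j \<in> borel_measurable M) \<and>
     (\<exists>G A. A \<in> sets M \<and>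
        (\<forall>j\<in>{1..n}. subalgebra M (G j) \<and>
           (AE \<omega> in M. X j \<omega> = real_cond_exp M (G j) (indicator A) \<omega>)))"

text \<open>Meaningful for \<open>n \<ge> 2\<close>, when the maximum is over a nonempty set.\<close>

definition spread_prob :: "'a measure \<Rightarrow> nat \<Rightarrow> (nat \<Rightarrow> 'a \<Rightarrow> real) \<Rightarrow> real \<Rightarrow> real" where
  "spread_prob M n X \<delta> =
     measure M {\<omega> \<in> space M. Max {\<bar>X i \<omega> - X j \<omega>\<bar> | i j. 1 \<le> i \<and> i < j \<and> j \<le> n} \<ge> \<delta>}"

end

theory Submission
  imports Defs
begin

text \<open>Put \<open>a = (1 - \<delta>) / (2 - \<delta>)\<close>. The upper bound is a linear programming duality argument: since
  \<open>E[g (X\<^sub>i) (1\<^sub>A - X\<^sub>i)] = 0\<close> for every bounded \<open>g\<close>, it suffices to find \<open>g\<close> with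
  \<open>1 \<le> (\<Sum>i. a + g (X\<^sub>i) (1\<^sub>A - X\<^sub>i))\<close> on the event and all summands nonnegative. The step function
  with value \<open>-1 / (2 - \<delta>)\<close> above \<open>\<delta>\<close>, \<open>1 / (2 - \<delta>)\<close> below \<open>1 - \<delta>\<close> and \<open>0\<close> in between works.

  When \<open>n a \<le> 1\<close>, complementary slackness dictates the extremal vector: on \<open>A\<close> all coordinates equal
  \<open>\<delta>\<close>, except that with probability \<open>n a\<close> one coordinate is \<open>1\<close> and another one is \<open>1 - \<delta>\<close>;
  off \<open>A\<close> the picture is reflected by \<open>x \<mapsto> 1 - x\<close>. When \<open>n a > 1\<close>, the
  vector built for the larger threshold \<open>(n - 2) / (n - 1)\<close>, for which \<open>n a = 1\<close>, is used instead.\<close>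

section \<open>The spread event in terms of ordered differences\<close>

text \<open>Ranging over both orders of a pair absorbs the absolute value, and
  \<open>\<delta> > 0\<close> rules out \<open>i = j\<close>. The finite quantifiers make the event
  visibly measurable and supply the ordered pair that the dual estimate uses.\<close>

lemma Max_spread_ge_iff:
  fixes x :: "nat \<Rightarrow> real"
  assumes "n \<ge> 2" and "\<delta> > 0"
  shows "\<delta> \<le> Max {\<bar>x i - x j\<bar> | i j. 1 \<le> i \<and> i < j \<and> j \<le> n} \<longleftrightarrow>
    (\<exists>i\<in>{1..n}. \<exists>j\<in>{1..n}. \<delta> \<le> x i - x j)" (is "_ \<le> Max ?S \<longleftrightarrow> _")
proof -
  have "?S \<subseteq> (\<lambda>(i, j). \<bar>x i - x j\<bar>) ` ({1..n} \<times> {1..n})"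
    by force
  then have "finite ?S"
    by (rule finite_subset) auto
  moreover have "\<bar>x 1 - x 2\<bar> \<in> ?S"
    using assms(1) by force
  ultimately have "\<delta> \<le> Max ?S \<longleftrightarrow> (\<exists>y\<in>?S. \<delta> \<le> y)"
    by (intro Max_ge_iff) auto
  also have "\<dots> \<longleftrightarrow> (\<exists>i\<in>{1..n}. \<exists>j\<in>{1..n}. \<delta> \<le> x i - x j)"
  proof
    assume "\<exists>y\<in>?S. \<delta> \<le> y"
    then obtain i j where ij: "1 \<le> i" "i < j" "j \<le> n" "\<delta> \<le> \<bar>x i - x j\<bar>"
      by blast
    then have "\<delta> \<le> x i - x j \<or> \<delta> \<le> x j - x i" "i \<in> {1..n}" "j \<in> {1..n}"
      by auto
    then show "\<exists>i\<in>{1..n}. \<exists>j\<in>{1..n}. \<delta> \<le> x i - x j"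
      by blast
  next
    assume "\<exists>i\<in>{1..n}. \<exists>j\<in>{1..n}. \<delta> \<le> x i - x j"
    then obtain i j where ij: "i \<in> {1..n}" "j \<in> {1..n}" "\<delta> \<le> x i - x j"
      by blast
    then consider "i < j" | "j < i"
      using assms(2) by (cases i j rule: linorder_cases) auto
    then show "\<exists>y\<in>?S. \<delta> \<le> y"
    proof cases
      case 1
      then have "\<bar>x i - x j\<bar> \<in> ?S" using ij by force
      with ij show ?thesis by (intro bexI[of _ "\<bar>x i - x j\<bar>"]) auto
    next
      case 2
      then have "\<bar>x j - x i\<bar> \<in> ?S" using ij by force
      with ij show ?thesis by (intro bexI[of _ "\<bar>x j - x i\<bar>"]) auto
    qed
  qed
  finally show ?thesis .
qed

section \<open>Upper bound: pointwise dual inequality and its integration\<close>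

definition dual_weight :: "real \<Rightarrow> real \<Rightarrow> real" where
  "dual_weight \<delta> x = (if \<delta> \<le> x then - (1 / (2 - \<delta>)) else if x \<le> 1 - \<delta> then 1 / (2 - \<delta>) else 0)"

lemma dual_weight_measurable [measurable]: "dual_weight \<delta> \<in> borel_measurable borel"
  unfolding dual_weight_def by measurable

text \<open>If \<open>\<delta> \<le> x\<close>, then \<open>c - x \<le> 1 - \<delta>\<close> because
  \<open>c \<le> 1\<close>; if \<open>x \<le> 1 - \<delta>\<close>, then
  \<open>c - x \<ge> -(1 - \<delta>)\<close> because \<open>c \<ge> 0\<close>.\<close>

lemma dual_term_nonneg:
  fixes c x \<delta> :: real
  assumes "1/2 < \<delta>" "\<delta> \<le> 1" "c = 0 \<or> c = 1" "0 \<le> x" "x \<le> 1"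
  shows "0 \<le> (1 - \<delta>) / (2 - \<delta>) + dual_weight \<delta> x * (c - x)"
proof -
  have "(1 - \<delta>) / (2 - \<delta>) + dual_weight \<delta> x * (c - x) =
      (if \<delta> \<le> x then 1 - \<delta> - (c - x) else if x \<le> 1 - \<delta> then 1 - \<delta> + (c - x) else 1 - \<delta>) / (2 - \<delta>)"
    by (simp add: dual_weight_def add_divide_distrib diff_divide_distrib)
  also have "\<dots> \<ge> 0"
    using assms by (intro divide_nonneg_nonneg) auto
  finally show ?thesis .
qed

text \<open>The gap forces \<open>x\<close> into the top zone and \<open>y\<close> into the bottom
  one. Their weights are opposite, so \<open>c\<close> cancels and only \<open>x - y\<close>
  remains.\<close>

lemma dual_pair_ge_1:
  fixes c x y \<delta> :: real
  assumes "1/2 < \<delta>" "\<delta> \<le> 1" "0 \<le> y" "x \<le> 1" "\<delta> \<le> x - y"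
  shows "1 \<le> ((1 - \<delta>) / (2 - \<delta>) + dual_weight \<delta> x * (c - x)) +
             ((1 - \<delta>) / (2 - \<delta>) + dual_weight \<delta> y * (c - y))"
proof -
  have "dual_weight \<delta> x = - (1 / (2 - \<delta>))" "dual_weight \<delta> y = 1 / (2 - \<delta>)"
    using assms by (auto simp: dual_weight_def)
  then have "((1 - \<delta>) / (2 - \<delta>) + dual_weight \<delta> x * (c - x)) +
      ((1 - \<delta>) / (2 - \<delta>) + dual_weight \<delta> y * (c - y)) = (2 - 2 * \<delta> + (x - y)) / (2 - \<delta>)"
    by (simp add: add_divide_distrib diff_divide_distrib)
  also have "\<dots> \<ge> 1"
    using assms by (simp add: field_simps)
  finally show ?thesis .
qed

lemma dual_sum_ge_indicator:
  fixes x :: "nat \<Rightarrow> real"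
  assumes "1/2 < \<delta>" "\<delta> \<le> 1" "c = 0 \<or> c = 1" "finite I" "\<And>i. i \<in> I \<Longrightarrow> 0 \<le> x i \<and> x i \<le> 1"
  shows "of_bool (\<exists>i\<in>I. \<exists>j\<in>I. \<delta> \<le> x i - x j) \<le>
    (\<Sum>i\<in>I. (1 - \<delta>) / (2 - \<delta>) + dual_weight \<delta> (x i) * (c - x i))" (is "_ \<le> sum ?k I")
proof (cases "\<exists>i\<in>I. \<exists>j\<in>I. \<delta> \<le> x i - x j")
  case True
  then obtain i j where ij: "i \<in> I" "j \<in> I" "\<delta> \<le> x i - x j"
    by blast
  then have "i \<noteq> j"
    using assms(1) by auto
  have "1 \<le> ?k i + ?k j"
    using assms ij by (intro dual_pair_ge_1) auto
  also have "\<dots> = sum ?k {i, j}"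
    using \<open>i \<noteq> j\<close> by simp
  also have "\<dots> \<le> sum ?k I"
    using ij assms by (intro sum_mono2 dual_term_nonneg) auto
  finally show ?thesis
    using True by simp
next
  case False
  then show ?thesis
    using assms by (simp only: of_bool_eq) (intro sum_nonneg dual_term_nonneg, auto)
qed

text \<open>The error \<open>indicator A - X\<close> of a conditional expectation is orthogonal to
  every bounded Borel function of \<open>X\<close>.\<close>

lemma (in prob_space) coherent_dual_integral:
  assumes sub: "subalgebra M G" and A: "A \<in> sets M" and X: "X \<in> borel_measurable M"
    and eq: "AE \<omega> in M. X \<omega> = real_cond_exp M G (indicator A) \<omega>"
    and g [measurable]: "g \<in> borel_measurable borel" and bd: "\<And>x. \<bar>g x\<bar> \<le> B"
  shows "AE \<omega> in M. 0 \<le> X \<omega> \<and> X \<omega> \<le> 1"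
    and "integrable M (\<lambda>\<omega>. g (X \<omega>) * (indicator A \<omega> - X \<omega>))"
    and "(\<integral>\<omega>. g (X \<omega>) * (indicator A \<omega> - X \<omega>) \<partial>M) = 0"
proof -
  interpret S: sigma_finite_subalgebra M G
    by (intro finite_measure_subalgebra_is_sigma_finite finite_measure_subalgebra.intro
        finite_measure_subalgebra_axioms.intro sub finite_measure_axioms)
  \<comment> \<open>\<open>X\<close> need not itself be \<open>G\<close>-measurable, so the
    orthogonality is proved for the version \<open>?Y\<close> and carried over almost
    everywhere.\<close>
  let ?Y = "real_cond_exp M G (indicator A)"
  note [measurable] = A X
  have intA: "integrable M (indicator A :: 'a \<Rightarrow> real)"
    by (intro integrable_const_bound[of _ 1]) (auto simp: indicator_def)
  have "AE \<omega> in M. 0 \<le> ?Y \<omega>" "AE \<omega> in M. ?Y \<omega> \<le> 1"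
    by (intro S.real_cond_exp_ge_c S.real_cond_exp_le_c intA; simp add: indicator_def)+
  with eq show AE01: "AE \<omega> in M. 0 \<le> X \<omega> \<and> X \<omega> \<le> 1"
    by eventually_elim auto
  have gY: "(\<lambda>\<omega>. g (?Y \<omega>)) \<in> borel_measurable G"
    by measurable
  have i1: "integrable M (\<lambda>\<omega>. g (?Y \<omega>) * indicator A \<omega>)"
    using bd by (intro integrable_const_bound[of _ "\<bar>B\<bar>"])
      (auto simp: indicator_def abs_mult intro!: AE_I2 order.trans[OF bd])
  note i2 = S.real_cond_exp_intg[OF i1 gY]
  have i3: "integrable M (\<lambda>\<omega>. g (?Y \<omega>) * ?Y \<omega>)"
    and "(\<integral>\<omega>. g (?Y \<omega>) * ?Y \<omega> \<partial>M) = (\<integral>\<omega>. g (?Y \<omega>) * indicator A \<omega> \<partial>M)"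
    using i2 by auto
  then have *: "(\<integral>\<omega>. g (?Y \<omega>) * (indicator A \<omega> - ?Y \<omega>) \<partial>M) = 0"
    using i1 by (simp add: right_diff_distrib)
  have ae: "AE \<omega> in M. g (?Y \<omega>) * (indicator A \<omega> - ?Y \<omega>) = g (X \<omega>) * (indicator A \<omega> - X \<omega>)"
    using eq by eventually_elim simp
  have **: "integrable M (\<lambda>\<omega>. g (?Y \<omega>) * (indicator A \<omega> - ?Y \<omega>))"
    using i1 i3 by (simp add: right_diff_distrib)
  show "integrable M (\<lambda>\<omega>. g (X \<omega>) * (indicator A \<omega> - X \<omega>))"
    by (rule integrable_cong_AE_imp[OF **]) (use ae in auto)
  show "(\<integral>\<omega>. g (X \<omega>) * (indicator A \<omega> - X \<omega>) \<partial>M) = 0"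
    unfolding *[symmetric] by (rule integral_cong_AE) (use ae in auto)
qed

text \<open>Integrating the pointwise inequality removes every weighted error term and leaves
  \<open>n\<close> copies of the constant.\<close>

lemma coherent_spread_prob_le:
  assumes "1/2 < \<delta>" "\<delta> \<le> 1" "n \<ge> 2" "coherent M n X"
  shows "spread_prob M n X \<delta> \<le> n * (1 - \<delta>) / (2 - \<delta>)"
proof -
  from assms(4) obtain G A where prob: "prob_space M"
    and X: "\<And>j. j \<in> {1..n} \<Longrightarrow> X j \<in> borel_measurable M" and A: "A \<in> sets M"
    and sub: "\<And>j. j \<in> {1..n} \<Longrightarrow> subalgebra M (G j)"
    and eq: "\<And>j. j \<in> {1..n} \<Longrightarrow> AE \<omega> in M. X j \<omega> = real_cond_exp M (G j) (indicator A) \<omega>"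
    unfolding coherent_def by blast
  interpret prob_space M by (rule prob)
  let ?D = "{\<omega> \<in> space M. \<exists>i\<in>{1..n}. \<exists>j\<in>{1..n}. \<delta> \<le> X i \<omega> - X j \<omega>}"
  let ?h = "\<lambda>j \<omega>. dual_weight \<delta> (X j \<omega>) * (indicator A \<omega> - X j \<omega>)"
  let ?Z = "\<lambda>\<omega>. \<Sum>j\<in>{1..n}. (1 - \<delta>) / (2 - \<delta>) + ?h j \<omega>"
  have bd: "\<bar>dual_weight \<delta> x\<bar> \<le> 1 / (2 - \<delta>)" for x
    using assms by (auto simp: dual_weight_def)
  note dual = coherent_dual_integral[OF sub A X eq dual_weight_measurable bd]
  have D: "?D \<in> sets M"
    using X by measurable
  have "AE \<omega> in M. \<forall>j\<in>{1..n}. 0 \<le> X j \<omega> \<and> X j \<omega> \<le> 1"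
    using dual(1) by (subst AE_ball_countable) auto
  then have ae: "AE \<omega> in M. indicator ?D \<omega> \<le> ?Z \<omega>"
  proof eventually_elim
    case (elim \<omega>)
    have "indicator ?D \<omega> \<le> (of_bool (\<exists>i\<in>{1..n}. \<exists>j\<in>{1..n}. \<delta> \<le> X i \<omega> - X j \<omega>) :: real)"
      by (simp add: indicator_def)
    also have "\<dots> \<le> ?Z \<omega>"
      by (rule dual_sum_ge_indicator) (use assms elim in \<open>auto simp: indicator_def\<close>)
    finally show ?case .
  qed
  have "spread_prob M n X \<delta> = prob ?D"
    using assms Max_spread_ge_iff[of n \<delta>] by (simp add: spread_prob_def)
  also have "\<dots> = (\<integral>\<omega>. indicator ?D \<omega> \<partial>M)"
    using D by simp
  also have "\<dots> \<le> (\<integral>\<omega>. ?Z \<omega> \<partial>M)"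
    using ae D dual(2)
    by (intro integral_mono_AE Bochner_Integration.integrable_sum Bochner_Integration.integrable_add)
      (auto intro!: integrable_real_indicator simp: emeasure_eq_measure)
  also have "\<dots> = (\<Sum>j\<in>{1..n}. (1 - \<delta>) / (2 - \<delta>) + (\<integral>\<omega>. ?h j \<omega> \<partial>M))"
    using dual(2) by (subst Bochner_Integration.integral_sum) (auto simp: prob_space)
  also have "\<dots> = n * (1 - \<delta>) / (2 - \<delta>)"
    using dual(3) by simp
  finally show ?thesis .
qed

section \<open>The extremal vector on finitely many atoms\<close>

text \<open>The atoms are \<open>\<plusminus>1, \<dots>, \<plusminus>(n + 1)\<close>, and \<open>A\<close> consists of the positive ones. At \<open>\<plusminus>k\<close> with \<open>k \<le> n\<close>
  the \<open>k\<close>-th coordinate and its cyclic successor are exceptional; \<open>\<plusminus>(n + 1)\<close> carries the part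
  where all coordinates agree.\<close>

definition signed_atoms :: "nat \<Rightarrow> real set" where
  "signed_atoms N = real ` {1..N} \<union> (\<lambda>k. - real k) ` {1..N}"

lemma finite_signed_atoms: "finite (signed_atoms N)"
  by (simp add: signed_atoms_def)

lemma sum_signed_atoms:
  "(\<Sum>\<omega>\<in>signed_atoms N. f \<omega>) = (\<Sum>k=1..N. f (real k) + f (- real k))"
proof -
  have "real ` {1..N} \<inter> (\<lambda>k. - real k) ` {1..N} = {}"
  proof -
    have "x > 0" if "x \<in> real ` {1..N}" for x using that by auto
    moreover have "x < 0" if "x \<in> (\<lambda>k. - real k) ` {1..N}" for x using that by auto
    ultimately show ?thesis by fastforce
  qed
  then have "(\<Sum>\<omega>\<in>signed_atoms N. f \<omega>) = sum f (real ` {1..N}) + sum f ((\<lambda>k. - real k) ` {1..N})"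
    unfolding signed_atoms_def by (intro sum.union_disjoint) auto
  also have "\<dots> = (\<Sum>k=1..N. f (real k)) + (\<Sum>k=1..N. f (- real k))"
    by (subst (1 2) sum.reindex) (auto simp: inj_on_def)
  finally show ?thesis
    by (simp add: sum.distrib)
qed

text \<open>The predecessor appears because coherence is checked for a fixed coordinate
  \<open>j\<close>: its exceptional atoms are \<open>j\<close> itself and the one whose cyclic
  successor is \<open>j\<close>.\<close>

definition cyc_pred :: "nat \<Rightarrow> nat \<Rightarrow> nat" where
  "cyc_pred n j = (if j = 1 then n else j - 1)"

definition ext_val :: "nat \<Rightarrow> real \<Rightarrow> nat \<Rightarrow> nat \<Rightarrow> real" where
  "ext_val n d j k = (if k = j then 1 else if k = cyc_pred n j then 1 - d else d)"

definition ext_vec :: "nat \<Rightarrow> real \<Rightarrow> nat \<Rightarrow> real \<Rightarrow> real" where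
  "ext_vec n d j \<omega> = (let x = ext_val n d j (nat \<lfloor>\<bar>\<omega>\<bar>\<rfloor>) in if \<omega> > 0 then x else 1 - x)"

text \<open>This is the mass of one signed atom, hence the halves; the last pair of atoms shares
  what the first \<open>n\<close> pairs leave.\<close>

definition ext_weight :: "nat \<Rightarrow> real \<Rightarrow> nat \<Rightarrow> real" where
  "ext_weight n d k = (if k \<le> n then (1 - d) / (2 - d) / 2 else 1/2 - n * (1 - d) / (2 - d) / 2)"

definition ext_measure :: "nat \<Rightarrow> real \<Rightarrow> real measure" where
  "ext_measure n d = point_measure (signed_atoms (n + 1)) (\<lambda>\<omega>. ext_weight n d (nat \<lfloor>\<bar>\<omega>\<bar>\<rfloor>))"

lemma ext_vec_of_nat:
  assumes "k \<ge> 1"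
  shows "ext_vec n d j (real k) = ext_val n d j k" "ext_vec n d j (- real k) = 1 - ext_val n d j k"
  using assms by (auto simp: ext_vec_def)

lemma ext_weight_nonneg:
  assumes "d \<le> 1" "n * (1 - d) / (2 - d) \<le> 1"
  shows "0 \<le> ext_weight n d k"
  using assms by (auto simp: ext_weight_def)

lemma sum_ext_weight:
  "(\<Sum>k=1..n. ext_weight n d k) = n * (1 - d) / (2 - d) / 2"
  by (simp add: ext_weight_def)

lemma integral_ext_measure:
  fixes f :: "real \<Rightarrow> real"
  assumes "d \<le> 1" "n * (1 - d) / (2 - d) \<le> 1"
  shows "integral\<^sup>L (ext_measure n d) f =
    (\<Sum>k=1..n+1. ext_weight n d k * (f (real k) + f (- real k)))"
  unfolding ext_measure_def
  using ext_weight_nonneg[OF assms] finite_signed_atoms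
  by (subst lebesgue_integral_point_measure_finite)
    (simp_all only: sum_signed_atoms, auto simp: algebra_simps)

lemma prob_space_ext_measure:
  assumes "d \<le> 1" "n * (1 - d) / (2 - d) \<le> 1"
  shows "prob_space (ext_measure n d)"
proof
  have halves: "2 * (t / 2) + 2 * (1/2 - t / 2) = 1" for t :: real
    by simp
  have "(\<Sum>\<omega>\<in>signed_atoms (n + 1). ext_weight n d (nat \<lfloor>\<bar>\<omega>\<bar>\<rfloor>)) =
      2 * (\<Sum>k=1..n. ext_weight n d k) + 2 * ext_weight n d (n + 1)"
    by (simp add: sum_signed_atoms sum_distrib_left)
  also have "\<dots> = 1"
    using halves[of "n * (1 - d) / (2 - d)"]
    by (simp only: sum_ext_weight ext_weight_def) simp
  finally have "(\<Sum>\<omega>\<in>signed_atoms (n + 1). ext_weight n d (nat \<lfloor>\<bar>\<omega>\<bar>\<rfloor>)) = 1" .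
  then show "emeasure (ext_measure n d) (space (ext_measure n d)) = 1"
    unfolding ext_measure_def
    using ext_weight_nonneg[OF assms] finite_signed_atoms
    by (simp add: space_point_measure emeasure_point_measure_finite sum_ennreal)
qed

text \<open>This is the orthogonality relation for coordinate \<open>j\<close>, with the atoms of
  opposite sign paired. Atom \<open>j\<close> contributes \<open>0\<close>, its predecessor
  \<open>- a / 2 * d * K\<close>, and the others, of total weight \<open>1/2 - a\<close>, contribute
  \<open>(1/2 - a) * (1 - d) * K\<close>. The choice \<open>a = (1 - d) / (2 - d)\<close> makes
  these cancel.\<close>

lemma ext_vec_balance:
  assumes "d \<le> 1" "n \<ge> 2" "j \<in> {1..n}"
  shows "(\<Sum>k=1..n+1. ext_weight n d k * ((1 - ext_val n d j k) *
    (h (ext_val n d j k) - h (1 - ext_val n d j k)))) = (0::real)"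
proof -
  let ?p = "cyc_pred n j"
  let ?f = "\<lambda>k. ext_weight n d k * ((1 - ext_val n d j k) *
    (h (ext_val n d j k) - h (1 - ext_val n d j k)))"
  define R where "R = {1..n} - {j, ?p}"
  define K where "K = h d - h (1 - d)"
  have p: "?p \<in> {1..n}" "?p \<noteq> j"
    using assms by (auto simp: cyc_pred_def split: if_splits)
  have eq: "{1..n+1} = insert (n + 1) (insert j (insert ?p R))"
    using p assms by (auto simp: R_def)
  have "card R = n - 2"
    using p assms by (simp add: R_def card_Diff_subset)
  then have cR: "real (card R) = real n - 2"
    using assms by simp
  define a where "a = (1 - d) / (2 - d)"
  have w: "ext_weight n d k = (if k \<le> n then a / 2 else 1/2 - n * a / 2)" for k
    by (simp add: ext_weight_def a_def)
  have "sum ?f R = (\<Sum>k\<in>R. a / 2 * ((1 - d) * K))"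
    by (intro sum.cong) (auto simp: R_def w ext_val_def K_def)
  then have 1: "sum ?f R = (real n - 2) * (a / 2 * ((1 - d) * K))"
    by (simp add: cR)
  have 2: "?f (n + 1) = (1/2 - n * a / 2) * ((1 - d) * K)"
    using p assms by (simp add: w ext_val_def K_def)
  have 3: "?f j = 0" "?f ?p = a / 2 * (d * - K)"
    using p assms by (auto simp: w ext_val_def K_def)
  have notin: "n + 1 \<notin> insert j (insert ?p R)" "j \<notin> insert ?p R" "?p \<notin> R" "finite R"
    using p assms by (auto simp: R_def)
  then have "sum ?f {1..n+1} = ?f (n + 1) + (?f j + (?f ?p + sum ?f R))"
    unfolding eq by (simp only: sum.insert finite_insert not_False_eq_True)
  also have "\<dots> = K / 2 * ((1 - d) - a * (2 - d))"
    unfolding 1 2 3 by (simp add: algebra_simps diff_divide_distrib add_divide_distrib)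
  also have "\<dots> = 0"
    using assms by (simp add: a_def)
  finally show ?thesis .
qed

text \<open>Each coordinate is shown to be the conditional probability of \<open>A\<close> given the
  sigma-algebra that it generates.\<close>

lemma coherent_ext_vec:
  assumes "d \<le> 1" "n \<ge> 2" "n * (1 - d) / (2 - d) \<le> 1"
  shows "coherent (ext_measure n d) n (ext_vec n d)"
proof -
  let ?M = "ext_measure n d"
  interpret prob_space ?M
    using assms by (intro prob_space_ext_measure)
  have meas: "f \<in> borel_measurable ?M" for f :: "real \<Rightarrow> real"
    by (simp add: ext_measure_def)
  have int: "integrable ?M f" for f :: "real \<Rightarrow> real"
  proof (rule integrable_const_bound[OF _ meas])
    have "finite (space ?M)"
      by (simp add: ext_measure_def space_point_measure finite_signed_atoms)
    then show "AE x in ?M. norm (f x) \<le> Max ((\<lambda>x. norm (f x)) ` space ?M)"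
      by (intro AE_I2 Max_ge) auto
  qed
  define A where "A = {\<omega> \<in> space ?M. \<omega> > 0}"
  have A: "A \<in> sets ?M"
    by (auto simp: A_def ext_measure_def space_point_measure sets_point_measure)
  have atoms: "real k \<in> space ?M" "- real k \<in> space ?M" if "k \<in> {1..n+1}" for k
    using that by (auto simp: ext_measure_def space_point_measure signed_atoms_def)
  define G where "G = (\<lambda>j. vimage_algebra (space ?M) (ext_vec n d j) borel)"
  have sub: "subalgebra ?M (G j)" for j
    unfolding subalgebra_def G_def
    by (auto simp: sets_vimage_algebra2 ext_measure_def space_point_measure sets_point_measure)
  have "AE \<omega> in ?M. real_cond_exp ?M (G j) (indicator A) \<omega> = ext_vec n d j \<omega>"
    if j: "j \<in> {1..n}" for j
  proof -
    interpret S: sigma_finite_subalgebra ?M "G j"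
      by (intro finite_measure_subalgebra_is_sigma_finite finite_measure_subalgebra.intro
        finite_measure_subalgebra_axioms.intro sub finite_measure_axioms)
    show ?thesis
    proof (rule S.real_cond_exp_charact[OF _ int int])
      show "ext_vec n d j \<in> borel_measurable (G j)"
        unfolding G_def by (rule measurable_vimage_algebra1) auto
      fix B assume "B \<in> sets (G j)"
      then obtain V where V: "B = ext_vec n d j -` V \<inter> space ?M"
        unfolding G_def by (auto simp: sets_vimage_algebra2)
      \<comment> \<open>Sets of \<open>G j\<close> are preimages under the coordinate, so their
        indicators are functions of its value and \<open>ext_vec_balance\<close> applies.\<close>
      define h :: "real \<Rightarrow> real" where "h = indicator V"
      have val: "indicator B \<omega> * (indicator A \<omega> - ext_vec n d j \<omega>) =
          h (ext_vec n d j \<omega>) * (of_bool (\<omega> > 0) - ext_vec n d j \<omega>)" if "\<omega> \<in> space ?M" for \<omega>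
        using that by (auto simp: V h_def A_def indicator_def)
      have "(\<integral>\<omega>. indicator B \<omega> * (indicator A \<omega> - ext_vec n d j \<omega>) \<partial>?M) =
          (\<Sum>k=1..n+1. ext_weight n d k * ((1 - ext_val n d j k) *
            (h (ext_val n d j k) - h (1 - ext_val n d j k))))"
        unfolding integral_ext_measure[OF assms(1,3)]
      proof (intro sum.cong refl)
        fix k assume k: "k \<in> {1..n+1}"
        then show "ext_weight n d k *
            (indicator B (real k) * (indicator A (real k) - ext_vec n d j (real k)) +
             indicator B (- real k) * (indicator A (- real k) - ext_vec n d j (- real k))) =
            ext_weight n d k * ((1 - ext_val n d j k) *
              (h (ext_val n d j k) - h (1 - ext_val n d j k)))"
          unfolding val[OF atoms(1)[OF k]] val[OF atoms(2)[OF k]]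
          by (simp add: ext_vec_of_nat algebra_simps)
      qed
      also have "\<dots> = 0"
        using assms j by (intro ext_vec_balance)
      finally have "(\<integral>\<omega>. indicator B \<omega> * indicator A \<omega> \<partial>?M) - (\<integral>\<omega>. indicator B \<omega> * ext_vec n d j \<omega> \<partial>?M) = 0"
        unfolding right_diff_distrib by (subst (asm) Bochner_Integration.integral_diff[OF int int])
      then show "(\<integral>\<omega>\<in>B. indicator A \<omega> \<partial>?M) = (\<integral>\<omega>\<in>B. ext_vec n d j \<omega> \<partial>?M)"
        unfolding set_lebesgue_integral_def real_scaleR_def by (rule eq_iff_diff_eq_0[THEN iffD2])
    qed
  qed
  then have "AE \<omega> in ?M. ext_vec n d j \<omega> = real_cond_exp ?M (G j) (indicator A) \<omega>"
    if "j \<in> {1..n}" for j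
    by (rule AE_symmetric) (use that in blast)
  then show ?thesis
    unfolding coherent_def using prob_space_axioms meas sub A by blast
qed

text \<open>At each atom of index \<open>k \<le> n\<close>, coordinate \<open>k\<close> and its
  cyclic successor differ by exactly \<open>d\<close> in absolute value. The parameter
  \<open>d\<close> may exceed \<open>\<delta>\<close>, which serves the case where the bound is
  capped at \<open>1\<close>.\<close>

lemma spread_prob_ext_vec_ge:
  assumes "0 < \<delta>" "\<delta> \<le> d" "d \<le> 1" "n \<ge> 2" "n * (1 - d) / (2 - d) \<le> 1"
  shows "n * (1 - d) / (2 - d) \<le> spread_prob (ext_measure n d) n (ext_vec n d) \<delta>"
proof -
  let ?M = "ext_measure n d"
  interpret prob_space ?M
    using assms by (intro prob_space_ext_measure)
  let ?D = "{\<omega> \<in> space ?M. \<exists>i\<in>{1..n}. \<exists>j\<in>{1..n}. \<delta> \<le> ext_vec n d i \<omega> - ext_vec n d j \<omega>}"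
  have sets: "?D \<in> sets ?M" "signed_atoms n \<in> sets ?M"
    by (auto simp: ext_measure_def space_point_measure sets_point_measure signed_atoms_def)
  have "signed_atoms n \<subseteq> ?D"
  proof
    fix \<omega> assume "\<omega> \<in> signed_atoms n"
    then obtain k where k: "k \<in> {1..n}" "\<omega> = real k \<or> \<omega> = - real k"
      unfolding signed_atoms_def by blast
    then have sp: "\<omega> \<in> space ?M"
      by (auto simp: ext_measure_def space_point_measure signed_atoms_def)
    \<comment> \<open>The cyclic successor of \<open>k\<close>; it differs from \<open>k\<close>
      because \<open>n \<ge> 2\<close>.\<close>
    define j where "j = (if k = n then 1 else k + 1)"
    have j: "j \<in> {1..n}" "cyc_pred n j = k" "j \<noteq> k"
      using k assms by (auto simp: j_def cyc_pred_def)
    then have "ext_val n d k k = 1" "ext_val n d j k = 1 - d"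
      by (auto simp: ext_val_def)
    then have "\<delta> \<le> ext_vec n d k \<omega> - ext_vec n d j \<omega> \<or> \<delta> \<le> ext_vec n d j \<omega> - ext_vec n d k \<omega>"
      using k assms by (auto simp: ext_vec_of_nat)
    then show "\<omega> \<in> ?D"
      using sp j k by blast
  qed
  then have "prob (signed_atoms n) \<le> prob ?D"
    using sets by (intro finite_measure_mono)
  moreover have "prob (signed_atoms n) = n * (1 - d) / (2 - d)"
  proof -
    have "signed_atoms n \<subseteq> signed_atoms (n + 1)"
      by (auto simp: signed_atoms_def)
    then have "prob (signed_atoms n) = (\<Sum>\<omega>\<in>signed_atoms n. ext_weight n d (nat \<lfloor>\<bar>\<omega>\<bar>\<rfloor>))"
      unfolding ext_measure_def using ext_weight_nonneg assms finite_signed_atoms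
      by (subst measure_point_measure_finite_if) auto
    also have "\<dots> = 2 * (\<Sum>k=1..n. ext_weight n d k)"
      by (simp add: sum_signed_atoms sum_distrib_left)
    also have "\<dots> = n * (1 - d) / (2 - d)"
      by (simp only: sum_ext_weight mult_2 field_sum_of_halves)
    finally show ?thesis .
  qed
  moreover have "spread_prob ?M n (ext_vec n d) \<delta> = prob ?D"
    unfolding spread_prob_def using Max_spread_ge_iff[of n \<delta>] assms by simp
  ultimately show ?thesis
    by simp
qed

section \<open>The value of the supremum\<close>

(* The supremum over all probability spaces, whose sample spaces may live in any type:
   the value bounds the probability on every type 'a, and it is the supremum
   already over the spaces whose sample space is a subset of the reals (with an
   arbitrary sigma-algebra). *)
theorem theorem1p2:
  fixes \<delta> :: real and n :: nat
  assumes "1/2 < \<delta>" and "\<delta> \<le> 1" and "n \<ge> 2"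
  shows "(\<forall>(M :: 'a measure) X. coherent M n X \<longrightarrow>
            spread_prob M n X \<delta> \<le> min (real n * (1 - \<delta>) / (2 - \<delta>)) 1) \<and>
         Sup {spread_prob M n X \<delta> | (M :: real measure) X. coherent M n X}
            = min (real n * (1 - \<delta>) / (2 - \<delta>)) 1"
proof -
  let ?v = "min (real n * (1 - \<delta>) / (2 - \<delta>)) 1"
  \<comment> \<open>The sample space type is left generic: the bound is used both on
    \<open>'a\<close> and on the reals.\<close>
  have le: "spread_prob M n X \<delta> \<le> ?v" if coh: "coherent M n X" for M :: "'b measure" and X
  proof -
    interpret prob_space M using coh by (simp add: coherent_def)
    have "spread_prob M n X \<delta> \<le> 1"
      by (simp add: spread_prob_def)
    with coherent_spread_prob_le[OF assms coh] show ?thesis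
      by simp
  qed
  obtain d :: real where d: "\<delta> \<le> d" "d \<le> 1" "real n * (1 - d) / (2 - d) = ?v"
  proof (cases "real n * (1 - \<delta>) / (2 - \<delta>) \<le> 1")
    case True
    then show thesis using that[of \<delta>] assms by simp
  next
    case False
    \<comment> \<open>The solution of \<open>n * (1 - d) = 2 - d\<close>. The case assumption
      \<open>n * (1 - \<delta>) > 2 - \<delta>\<close> rearranges to
      \<open>\<delta> < d\<close>.\<close>
    define d where "d = (real n - 2) / (real n - 1)"
    have "n * (1 - d) / (2 - d) = 1"
      using assms by (simp add: d_def field_simps)
    moreover have "\<delta> \<le> d"
      using False assms by (simp add: d_def field_simps)
    moreover have "d \<le> 1"
      using assms by (simp add: d_def field_simps)
    ultimately show thesis using False by (intro that[of d]) (simp_all only: min_def if_False)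
  qed
  have "Sup {spread_prob M n X \<delta> | (M :: real measure) X. coherent M n X} = ?v"
  proof (rule cSup_eq_maximum)
    have coh: "coherent (ext_measure n d) n (ext_vec n d)"
      using d assms by (intro coherent_ext_vec) auto
    have "?v \<le> spread_prob (ext_measure n d) n (ext_vec n d) \<delta>"
      using spread_prob_ext_vec_ge[where \<delta> = \<delta> and d = d and n = n] d assms by simp
    with le[OF coh] have "?v = spread_prob (ext_measure n d) n (ext_vec n d) \<delta>"
      by (intro antisym)
    with coh show "?v \<in> {spread_prob M n X \<delta> | (M :: real measure) X. coherent M n X}"
      by blast
    show "x \<le> ?v" if "x \<in> {spread_prob M n X \<delta> | (M :: real measure) X. coherent M n X}" for x
      using that le by blast
  qed
  with le show ?thesis by blast
qed

end
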